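(* For every real $\alpha>0$, $$\int_0^\infty \int_0^\infty\frac{e^{-x^2-y^2}\cos 2xy}{\cosh (\alpha x)\,\cosh(2\pi y/\alpha)}\,dx\,dy=\frac{\alpha}{2\sqrt{\pi}}\left(\int_0^\infty\frac{\cosh \frac{\alpha x}{2}}{\cosh \alpha x}\,e^{-x^2}\,dx \right)^2.$$ *)

theory Defs
  imports "HOL-Analysis.Analysis"
begin

end

(* Gaussian and sech are both essentially their own Fourier transforms, so the convolution theorem
   (here: Fubini) turns the y-integral of e^(-y^2) cos(2xy) / cosh(2 pi y / \<alpha>) into a multiple of
   the t-integral of e^(-t^2) / cosh(\<alpha>(x+t)/2).  The resulting double integral over the plane is
   symmetrised under swapping x and t: with u = \<alpha>x/2 and v = \<alpha>t/2,
     1/cosh 2u + 1/cosh 2v = 2 cosh(u+v) cosh(u-v) / (cosh 2u cosh 2v),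
   so the factor 1/cosh(u+v) cancels, and cosh(u-v) = cosh u cosh v - sinh u sinh v separates the
   variables; the sinh part integrates to 0 because it is odd. *)

theory Submission
  imports Defs "HOL-Real_Asymp.Real_Asymp" "HOL-Probability.Probability"
    "HOL-Complex_Analysis.Complex_Analysis"
begin

section \<open>Residue computation for \<open>exp (\<i> * t * z) / cosh (pi * z)\<close> on a
  rectangle\<close>

text \<open>Reverse triangle inequality for \<open>exp z\<close> and \<open>exp (- z)\<close>, whose
  moduli are \<open>exp (Re z)\<close> and \<open>exp (- Re z)\<close>. It makes the integrand small
  on the vertical sides of the rectangle.\<close>

lemma norm_cosh_ge_abs_sinh_Re: "\<bar>sinh (Re z)\<bar> \<le> norm (cosh z)"
proof -
  have "\<bar>exp (Re z) - exp (- Re z)\<bar> \<le> norm (exp z + exp (- z))"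
    using norm_triangle_ineq2[of "exp z" "- exp (- z)"] norm_triangle_ineq2[of "exp (- z)" "- exp z"]
    by (simp add: add.commute abs_le_iff)
  then show ?thesis
    by (simp add: sinh_field_def cosh_field_def norm_divide)
qed

lemma cosh_of_real: "cosh (of_real x :: complex) = of_real (cosh x)"
  by (simp add: cosh_field_def exp_of_real flip: of_real_minus)

text \<open>The zeros of \<open>cosh (pi * z)\<close> are the points \<open>\<i> * (k + 1/2)\<close>
  with \<open>k\<close> an integer. The open strip reaches exactly to the neighbours -\<i>/2 and
  3\<i>/2 of the zero \<i>/2.\<close>

lemma cosh_pi_eq_0_in_strip:
  assumes "cosh (of_real pi * z) = 0" "- 1 / 2 < Im z" "Im z < 3 / 2"
  shows "z = \<i> / 2"
proof -
  have "cos (\<i> * (of_real pi * z)) = 0"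
    using assms(1) by (simp add: cosh_conv_cos)
  then obtain n :: int where n: "\<i> * (of_real pi * z) = of_real (n * pi) + of_real pi / 2"
    by (auto simp: cos_eq_0)
  then have "of_real pi * (\<i> * z - (of_int n + 1 / 2)) = 0"
    by (simp add: algebra_simps)
  then have iz: "\<i> * z = of_int n + 1 / 2"
    by simp
  then have z: "z = - \<i> * (of_int n + 1 / 2)"
    by (metis (no_types, lifting) iz mult.assoc mult_1 i_squared minus_mult_left minus_minus mult_minus1 power2_i power2_eq_square)
  then have "Im z = - (of_int n + 1 / 2)" by simp
  with assms have "n = -1" by linarith
  with z show ?thesis by simp
qed

lemma holomorphic_on_cosh_mult: "(\<lambda>z::complex. cosh (a * z)) holomorphic_on A"
  by (intro analytic_imp_holomorphic analytic_intros)

text \<open>The only pole enclosed is the simple one at \<i>/2. Its residue is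
  \<open>exp (- t / 2) / (pi * \<i>)\<close>, because \<open>cosh (pi * z)\<close> has derivative
  \<open>pi * \<i>\<close> there.\<close>

lemma contour_integral_rectpath_exp_div_cosh:
  fixes t R :: real
  assumes "R > 0"
  shows "contour_integral (rectpath (- of_real R) (of_real R + \<i>))
           (\<lambda>z. exp (\<i> * of_real t * z) / cosh (of_real pi * z)) = 2 * exp (- of_real t / 2)"
proof -
  \<comment> \<open>An open convex neighbourhood of every rectangle of height 1 on the real axis,
    still free of other poles; convexity gives winding number 0 outside it.\<close>
  define S where "S = {z. - 1 / 2 < Im z \<and> Im z < 3 / 2}"
  let ?f = "\<lambda>z::complex. exp (\<i> * of_real t * z) / cosh (of_real pi * z)"
  let ?g = "rectpath (- of_real R) (of_real R + \<i>)"
  have S: "S = {z. Im z > - 1 / 2} \<inter> {z. Im z < 3 / 2}" by (auto simp: S_def)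
  have "open S" unfolding S by (intro open_Int open_halfspace_Im_gt open_halfspace_Im_lt)
  have "convex S" unfolding S by (intro convex_Int convex_halfspace_Im_gt convex_halfspace_Im_lt)
  have "connected S" using \<open>convex S\<close> by (rule convex_connected)
  have image: "path_image ?g \<subseteq> S - {\<i> / 2}"
    using assms by (subst path_image_rectpath) (auto simp: S_def)
  have i_pi_i: "\<i> * (of_real pi * (\<i> / 2)) = - of_real (pi / 2)"
    by (simp add: complex_eq_iff)
  have "contour_integral ?g ?f
      = 2 * pi * \<i> * (\<Sum>p\<in>{\<i> / 2}. winding_number ?g p * residue ?f p)"
  proof (rule Residue_theorem[OF \<open>open S\<close> \<open>connected S\<close>])
    show "?f holomorphic_on S - {\<i> / 2}"
      using cosh_pi_eq_0_in_strip by (intro holomorphic_intros holomorphic_on_cosh_mult) (auto simp: S_def)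
    show "\<forall>z. z \<notin> S \<longrightarrow> winding_number ?g z = 0"
      using winding_number_zero_outside[of ?g S] \<open>convex S\<close> image by auto
  qed (use image in auto)
  moreover have "winding_number ?g (\<i> / 2) = 1"
    by (rule winding_number_rectpath) (use assms in \<open>auto simp: in_box_complex_iff\<close>)
  moreover have "residue ?f (\<i> / 2) = exp (\<i> * of_real t * (\<i> / 2)) / (of_real pi * \<i>)"
  proof (rule residue_simple_pole_deriv[OF _ _ \<open>open S\<close> \<open>connected S\<close>])
    show "((\<lambda>z. cosh (of_real pi * z)) has_field_derivative of_real pi * \<i>) (at (\<i> / 2))"
    proof -
      have "sinh (of_real pi * (\<i> / 2)) = \<i>"
        by (simp only: sinh_conv_sin i_pi_i sin_minus sin_of_real sin_pi_half) simp
      then show ?thesis by (auto intro!: derivative_eq_intros)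
    qed
    show "cosh (of_real pi * (\<i> / 2)) = 0"
      by (simp only: cosh_conv_cos i_pi_i cos_minus cos_of_real cos_pi_half of_real_0)
  qed (auto simp: S_def intro!: holomorphic_intros holomorphic_on_cosh_mult)
  moreover have "exp (\<i> * of_real t * (\<i> / 2)) = exp (- of_real t / 2)"
    by (rule arg_cong[where f = exp]) (simp add: complex_eq_iff)
  ultimately show ?thesis by (simp add: field_simps)
qed

section \<open>Measurability, integrability of sech, and truncated integrals\<close>

lemma borel_measurable_cosh [measurable]:
  fixes f :: "'a \<Rightarrow> real"
  assumes [measurable]: "f \<in> borel_measurable M"
  shows "(\<lambda>x. cosh (f x)) \<in> borel_measurable M"
  unfolding cosh_field_def by measurable

lemma borel_measurable_sinh [measurable]:
  fixes f :: "'a \<Rightarrow> real"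
  assumes [measurable]: "f \<in> borel_measurable M"
  shows "(\<lambda>x. sinh (f x)) \<in> borel_measurable M"
  unfolding sinh_field_def by measurable

lemma integrable_exp_abs: "integrable lborel (\<lambda>x::real. exp (- \<bar>x\<bar>))"
proof -
  have "has_bochner_integral lborel (\<lambda>x::real. indicator {0..} x *\<^sub>R exp (- \<bar>x\<bar>)) 1"
    using has_bochner_integral_I0i_power_exp_m'[of 0]
    by (rule has_bochner_integral_cong[THEN iffD1, rotated -1]) (auto split: split_indicator)
  from has_bochner_integral_even_function[OF this] show ?thesis
    by (auto simp: has_bochner_integral_iff)
qed

lemma integrable_sech:
  fixes c :: real
  assumes "c \<noteq> 0"
  shows "integrable lborel (\<lambda>x. 1 / cosh (c * x))"
proof -
  have "integrable lborel (\<lambda>x::real. 1 / cosh x)"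
  proof (rule Bochner_Integration.integrable_bound)
    show "integrable lborel (\<lambda>x::real. 2 * exp (- \<bar>x\<bar>))"
      by (intro integrable_mult_right integrable_exp_abs)
    \<comment> \<open>One of the two exponentials in \<open>2 * cosh x\<close> is
      \<open>exp \<bar>x\<bar>\<close>, so sech decays at least like
      \<open>2 * exp (- \<bar>x\<bar>)\<close>.\<close>
    have "exp \<bar>x\<bar> \<le> 2 * cosh x" for x :: real
      by (simp add: cosh_field_def abs_if)
    then show "AE x in lborel. norm (1 / cosh x) \<le> norm (2 * exp (- \<bar>x\<bar>) :: real)"
      by (auto simp: exp_minus field_simps)
  qed auto
  from lborel_integrable_real_affine[OF this assms, of 0] show ?thesis by simp
qed

text \<open>Dominated convergence with bound \<open>norm (f x)\<close>. It passes from integrals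
  over \<open>{- R..R}\<close>, the form that contour integrals along the real axis take, to the
  Lebesgue integral over the line.\<close>

lemma lborel_integral_limit_symmetric_intervals:
  fixes f :: "real \<Rightarrow> 'a::euclidean_space"
  assumes "integrable lborel f"
  shows "((\<lambda>R. integral {- R..R} f) \<longlongrightarrow> (\<integral>x. f x \<partial>lborel)) at_top"
proof -
  have "((\<lambda>R. LBINT x:{- R..R}. f x) \<longlongrightarrow> (\<integral>x. f x \<partial>lborel)) at_top"
    unfolding set_lebesgue_integral_def
  proof (rule integral_dominated_convergence_at_top)
    show "integrable lborel (\<lambda>x. norm (f x))" using assms by simp
    show "AE x in lborel. ((\<lambda>R. indicat_real {- R..R} x *\<^sub>R f x) \<longlongrightarrow> f x) at_top"
    proof (rule AE_I2)
      fix x :: real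
      have "\<forall>\<^sub>F R in at_top. f x = indicat_real {- R..R} x *\<^sub>R f x"
        using eventually_ge_at_top[of "\<bar>x\<bar>"] by eventually_elim (auto simp: indicator_def)
      then show "((\<lambda>R. indicat_real {- R..R} x *\<^sub>R f x) \<longlongrightarrow> f x) at_top"
        by (rule Lim_transform_eventually[OF tendsto_const])
    qed
  qed (use assms in \<open>auto split: split_indicator\<close>)
  moreover have "(LBINT x:{- R..R}. f x) = integral {- R..R} f" for R
    using assms by (intro set_borel_integral_eq_integral)
      (auto simp: set_integrable_def intro!: integrable_mult_indicator)
  ultimately show ?thesis by simp
qed

section \<open>Fourier transform of sech\<close>

text \<open>Shifting the contour by \<open>\<i>\<close> multiplies the integrand by \<open>- exp (- t)\<close>, so the two horizontal
  sides of the rectangle combine to \<open>1 + exp (- t)\<close> times the integral along the real axis.\<close>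

lemma has_bochner_integral_sech_Fourier_pi:
  fixes t :: real
  shows "has_bochner_integral lborel (\<lambda>y. exp (\<i> * of_real t * of_real y) / cosh (of_real pi * of_real y))
           (1 / cosh (of_real t / 2) :: complex)"
proof -
  let ?f = "\<lambda>z::complex. exp (\<i> * of_real t * z) / cosh (of_real pi * z)"
  define F where "F = (\<lambda>R. integral {- R..R} (\<lambda>x. ?f (of_real x)))"
  define L where "L = (\<integral>y. ?f (of_real y) \<partial>lborel)"
  have int: "integrable lborel (\<lambda>y. ?f (of_real y))"
  proof (rule Bochner_Integration.integrable_bound[OF integrable_sech[of pi]])
    show "AE x in lborel. norm (?f (complex_of_real x)) \<le> norm (1 / cosh (pi * x))"
      by (simp add: cosh_of_real norm_divide flip: of_real_mult)
  qed (simp_all add: cosh_of_real flip: of_real_mult)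
  \<comment> \<open>The residue identity with the horizontal sides merged. The error comes from the
    two vertical sides, each of length 1.\<close>
  have bound: "norm ((1 + exp (- of_real t)) * F R - 2 * exp (- of_real t / 2)) \<le> 2 * exp \<bar>t\<bar> / sinh (pi * R)"
    if "R > 0" for R
  proof -
    define a b c d :: complex where "a = - of_real R" and "b = of_real R"
      and "c = of_real R + \<i>" and "d = - of_real R + \<i>"
    have rect: "rectpath a c = linepath a b +++ linepath b c +++ linepath c d +++ linepath d a"
      by (simp add: rectpath_def Let_def a_def b_def c_def d_def complex_eq_iff Complex_eq)
    have "path_image (rectpath a c) = closed_segment a b \<union> closed_segment b c \<union> closed_segment c d \<union> closed_segment d a"
      unfolding rect by (simp add: path_image_join Un_assoc)
    \<comment> \<open>The only candidate zero \<i>/2 lies in the interior of the rectangle, so the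
      integrand is continuous on all four sides.\<close>
    moreover have "cosh (of_real pi * z) \<noteq> 0" if "z \<in> path_image (rectpath a c)" for z
    proof
      assume "cosh (of_real pi * z) = 0"
      then have "z = \<i> / 2"
        using that \<open>R > 0\<close> by (intro cosh_pi_eq_0_in_strip)
          (auto simp: path_image_rectpath a_def c_def)
      with that \<open>R > 0\<close> show False
        by (auto simp: path_image_rectpath a_def c_def)
    qed
    then have "continuous_on (path_image (rectpath a c)) ?f"
      by (intro continuous_intros) auto
    ultimately have integrable: "?f contour_integrable_on linepath a b" "?f contour_integrable_on linepath b c"
        "?f contour_integrable_on linepath c d" "?f contour_integrable_on linepath d a"
      by (auto intro!: contour_integrable_continuous_linepath elim!: continuous_on_subset)
    have "2 * exp (- of_real t / 2) = contour_integral (rectpath a c) ?f"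
      unfolding a_def c_def using contour_integral_rectpath_exp_div_cosh[OF that, of t] by simp
    also have "\<dots> = contour_integral (linepath a b) ?f + contour_integral (linepath b c) ?f
        + contour_integral (linepath c d) ?f + contour_integral (linepath d a) ?f"
      unfolding rect using integrable by simp
    also have "contour_integral (linepath a b) ?f = F R"
      using that by (subst contour_integral_linepath_Reals_eq) (auto simp: a_def b_def F_def)
    also have "contour_integral (linepath c d) ?f = exp (- of_real t) * F R"
    proof -
      have shift: "?f (z + \<i>) = - exp (- of_real t) * ?f z" for z
      proof -
        have "cosh (of_real pi * (z + \<i>)) = - cosh (of_real pi * z)"
          by (simp add: cosh_conv_cos algebra_simps cos_add cos_of_real sin_of_real cos_diff)
        moreover have "exp (\<i> * of_real t * (z + \<i>)) = exp (- of_real t) * exp (\<i> * of_real t * z)"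
          by (simp add: algebra_simps flip: exp_add)
        ultimately show ?thesis by simp
      qed
      \<comment> \<open>The top side runs from right to left, so it is a translate of the reversed
        bottom side. This reversal cancels the minus sign in \<open>shift\<close>.\<close>
      have cd: "linepath c d x = linepath b a x + \<i>" for x
        by (simp add: linepath_def a_def b_def c_def d_def algebra_simps scaleR_conv_of_real)
      have "contour_integral (linepath c d) ?f = integral {0..1} (\<lambda>x. ?f (linepath b a x + \<i>) * (a - b))"
        unfolding contour_integral_integral vector_derivative_linepath_at cd
        by (simp add: a_def b_def c_def d_def)
      also have "\<dots> = - exp (- of_real t) * contour_integral (linepath b a) ?f"
        unfolding shift contour_integral_integral vector_derivative_linepath_at
        by (simp only: mult.assoc integral_mult_right)
      also have "contour_integral (linepath b a) ?f = - contour_integral (linepath a b) ?f"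
        using contour_integral_reversepath[of "linepath a b" ?f] by simp
      also have "contour_integral (linepath a b) ?f = F R"
        using that by (subst contour_integral_linepath_Reals_eq) (auto simp: a_def b_def F_def)
      finally show ?thesis by simp
    qed
    finally have "(1 + exp (- of_real t)) * F R - 2 * exp (- of_real t / 2) =
        - (contour_integral (linepath b c) ?f + contour_integral (linepath d a) ?f)"
      by (simp add: algebra_simps)
    then have "norm ((1 + exp (- of_real t)) * F R - 2 * exp (- of_real t / 2))
        \<le> norm (contour_integral (linepath b c) ?f) + norm (contour_integral (linepath d a) ?f)"
      by (simp only: norm_minus_cancel norm_triangle_ineq)
    \<comment> \<open>The numerator has modulus \<open>exp (- (t * Im z))\<close>, where
      \<open>Im z\<close> lies between 0 and 1; the denominator is at least
      \<open>sinh (pi * R)\<close> in modulus.\<close>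
    moreover have side: "norm (?f z) \<le> exp \<bar>t\<bar> / sinh (pi * R)" if "\<bar>Re z\<bar> = R" "Im z \<in> {0..1}" for z
    proof -
      have "\<bar>sinh (pi * Re z)\<bar> = sinh \<bar>pi * Re z\<bar>"
        by (rule sinh_real_abs[symmetric])
      also have "\<bar>pi * Re z\<bar> = pi * R"
        using that by (simp add: abs_mult)
      finally have "\<bar>sinh (pi * Re z)\<bar> = sinh (pi * R)" .
      then have "sinh (pi * R) \<le> norm (cosh (of_real pi * z))"
        using norm_cosh_ge_abs_sinh_Re[of "of_real pi * z"] by simp
      moreover have "norm (exp (\<i> * of_real t * z)) \<le> exp \<bar>t\<bar>"
      proof -
        have "- (t * Im z) \<le> \<bar>t\<bar> * \<bar>Im z\<bar>"
          by (metis abs_ge_minus_self abs_mult)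
        also have "\<dots> \<le> \<bar>t\<bar> * 1"
          using that by (intro mult_left_mono) auto
        finally show ?thesis by simp
      qed
      ultimately show ?thesis
        using \<open>R > 0\<close> by (auto simp: norm_divide intro!: frac_le)
    qed
    have "norm (contour_integral (linepath b c) ?f) \<le> exp \<bar>t\<bar> / sinh (pi * R) * norm (c - b)"
    proof (rule contour_integral_bound_linepath[OF integrable(2)])
      fix z assume "z \<in> closed_segment b c"
      then have "Re z = R" "Im z \<in> {0..1}"
        by (auto simp: closed_segment_same_Re closed_segment_eq_real_ivl b_def c_def)
      with \<open>R > 0\<close> show "norm (?f z) \<le> exp \<bar>t\<bar> / sinh (pi * R)" by (intro side) auto
    qed (use that in auto)
    moreover have "norm (contour_integral (linepath d a) ?f) \<le> exp \<bar>t\<bar> / sinh (pi * R) * norm (a - d)"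
    proof (rule contour_integral_bound_linepath[OF integrable(4)])
      fix z assume "z \<in> closed_segment d a"
      then have "Re z = - R" "Im z \<in> {0..1}"
        by (auto simp: closed_segment_same_Re closed_segment_eq_real_ivl a_def d_def)
      with \<open>R > 0\<close> show "norm (?f z) \<le> exp \<bar>t\<bar> / sinh (pi * R)" by (intro side) auto
    qed (use that in auto)
    ultimately show ?thesis
      by (simp add: a_def b_def c_def d_def)
  qed
  have "((\<lambda>R. 2 * exp \<bar>t\<bar> / sinh (pi * R)) \<longlongrightarrow> 0) at_top"
    by real_asymp
  then have "((\<lambda>R. (1 + exp (- of_real t)) * F R - 2 * exp (- of_real t / 2)) \<longlongrightarrow> 0) at_top"
    by (rule Lim_null_comparison[rotated])
      (use eventually_gt_at_top[of 0] in eventually_elim, use bound in auto)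
  then have "(1 + exp (- of_real t)) * L - 2 * exp (- of_real t / 2) = 0"
  proof (rule tendsto_unique[rotated 2])
    show "((\<lambda>R. (1 + exp (- of_real t)) * F R - 2 * exp (- of_real t / 2))
      \<longlongrightarrow> (1 + exp (- of_real t)) * L - 2 * exp (- of_real t / 2)) at_top"
      unfolding F_def L_def by (intro tendsto_intros lborel_integral_limit_symmetric_intervals int)
  qed simp
  then have L: "(1 + exp (- of_real t)) * L = 2 * exp (- of_real t / 2)"
    by simp
  \<comment> \<open>Multiplying the identity \<open>L\<close> by \<open>exp (t / 2) / 2\<close>
    turns the coefficient of \<open>L\<close> into \<open>cosh (t / 2)\<close> and the right-hand
    side into 1.\<close>
  have "cosh (of_real t / 2) = exp (of_real t / 2) * (1 + exp (- of_real t)) / (2 :: complex)"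
    by (simp add: cosh_field_def distrib_left flip: exp_add)
  then have "cosh (of_real t / 2) * L = exp (of_real t / 2) * ((1 + exp (- of_real t)) * L) / 2"
    by (simp only: times_divide_eq_left mult.assoc)
  also have "\<dots> = exp (of_real t / 2) * (2 * exp (- of_real t / 2)) / 2"
    unfolding L ..
  also have "\<dots> = 1"
    by (simp flip: exp_add)
  finally have *: "cosh (of_real t / 2) * L = 1" .
  then have "cosh (of_real t / 2 :: complex) \<noteq> 0"
    by auto
  with * have "L = 1 / cosh (of_real t / 2)"
    by (intro eq_divide_imp) (simp_all add: mult.commute)
  with int show ?thesis unfolding L_def has_bochner_integral_iff by simp
qed

section \<open>Real Fourier integrals of the Gaussian and of rescaled sech\<close>

text \<open>The characteristic function of the standard normal distribution, rescaled by
  \<open>sqrt 2\<close>. Multiplying by \<open>iexp b\<close> before taking real parts brings in the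
  phase \<open>b\<close>, later used to absorb the shift in
  \<open>cos (2 * (x + t) * y)\<close>.\<close>

lemma has_bochner_integral_gaussian_cos:
  fixes a b :: real
  shows "has_bochner_integral lborel (\<lambda>x. exp (- x\<^sup>2) * cos (2 * a * x + b)) (sqrt pi * exp (- a\<^sup>2) * cos b)"
proof -
  have density: "std_normal_density (sqrt 2 * x) = exp (- x\<^sup>2) / sqrt (2 * pi)" for x
    by (simp add: std_normal_density_def power_mult_distrib)
  have "integrable lborel (\<lambda>x. std_normal_density (0 + sqrt 2 * x))"
    by (rule lborel_integrable_real_affine) auto
  then have "integrable lborel (\<lambda>x. sqrt (2 * pi) * std_normal_density (sqrt 2 * x))"
    by simp
  then have gauss: "integrable lborel (\<lambda>x::real. exp (- x\<^sup>2))"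
    by (simp add: density)
  have int: "integrable lborel (\<lambda>x. exp (- x\<^sup>2) *\<^sub>R iexp (2 * a * x))"
    by (rule Bochner_Integration.integrable_bound[OF gauss]) (auto simp: norm_mult)
  have eq: "sqrt 2 * a * (sqrt 2 * x) = 2 * a * x" for x
    by (simp add: algebra_simps)
  have "complex_of_real (exp (- a\<^sup>2)) = char std_normal_distribution (sqrt 2 * a)"
    by (simp add: char_std_normal_distribution power_mult_distrib)
  also have "\<dots> = (\<integral>x. std_normal_density x *\<^sub>R iexp (sqrt 2 * a * x) \<partial>lborel)"
    unfolding char_def by (subst integral_density) auto
  also have "\<dots> = sqrt 2 *\<^sub>R (\<integral>x. std_normal_density (0 + sqrt 2 * x) *\<^sub>R iexp (sqrt 2 * a * (0 + sqrt 2 * x)) \<partial>lborel)"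
    by (subst lborel_integral_real_affine[where c = "sqrt 2" and t = 0]) auto
  also have "\<dots> = sqrt 2 *\<^sub>R (\<integral>x. (1 / sqrt (2 * pi)) *\<^sub>R (exp (- x\<^sup>2) *\<^sub>R iexp (2 * a * x)) \<partial>lborel)"
    by (intro arg_cong[where f = "\<lambda>x. sqrt 2 *\<^sub>R x"] Bochner_Integration.integral_cong[OF refl])
      (simp only: add_0 density eq, simp)
  also have "\<dots> = (1 / sqrt pi) *\<^sub>R (\<integral>x. exp (- x\<^sup>2) *\<^sub>R iexp (2 * a * x) \<partial>lborel)"
  proof -
    have *: "sqrt 2 * (1 / sqrt (2 * pi)) = 1 / sqrt pi" by (simp add: real_sqrt_mult)
    show ?thesis by (simp only: integral_scaleR_right) (simp only: scaleR_scaleR *)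
  qed
  finally have "(\<integral>x. exp (- x\<^sup>2) *\<^sub>R iexp (2 * a * x) \<partial>lborel) = sqrt pi * exp (- a\<^sup>2)"
    by (simp add: scaleR_conv_of_real field_simps)
  with int have "has_bochner_integral lborel (\<lambda>x. exp (- x\<^sup>2) *\<^sub>R iexp (2 * a * x)) (of_real (sqrt pi * exp (- a\<^sup>2)))"
    by (simp add: has_bochner_integral_iff)
  then have "has_bochner_integral lborel (\<lambda>x. iexp b * (exp (- x\<^sup>2) *\<^sub>R iexp (2 * a * x))) (iexp b * of_real (sqrt pi * exp (- a\<^sup>2)))"
    by (intro has_bochner_integral_mult_right)
  from has_bochner_integral_Re[OF this] show ?thesis
    by (simp add: Re_exp Im_exp cos_add algebra_simps)
qed

text \<open>Real part of the sech transform at frequency \<open>pi * t / c\<close>, followed by the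
  substitution that replaces \<open>y\<close> by \<open>c * y / pi\<close>.\<close>

lemma has_bochner_integral_sech_cos:
  fixes c t :: real
  assumes "c > 0"
  shows "has_bochner_integral lborel (\<lambda>y. cos (t * y) / cosh (c * y)) (pi / (c * cosh (pi * t / (2 * c))))"
proof -
  have "has_bochner_integral lborel (\<lambda>y. Re (exp (\<i> * of_real (pi * t / c) * of_real y) / cosh (of_real pi * of_real y)))
           (Re (1 / cosh (of_real (pi * t / c) / 2)))"
    by (intro has_bochner_integral_Re has_bochner_integral_sech_Fourier_pi)
  also have "(\<lambda>y. Re (exp (\<i> * of_real (pi * t / c) * of_real y) / cosh (of_real pi * of_real y)))
      = (\<lambda>y. cos (pi * t / c * y) / cosh (pi * y))"
  proof
    fix y
    have "cosh (of_real pi * of_real y :: complex) = of_real (cosh (pi * y))"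
      by (simp flip: cosh_of_real)
    then show "Re (exp (\<i> * of_real (pi * t / c) * of_real y) / cosh (of_real pi * of_real y))
        = cos (pi * t / c * y) / cosh (pi * y)"
      by (simp add: Re_exp)
  qed
  also have "cosh (of_real (pi * t / c) / 2 :: complex) = of_real (cosh (pi * t / (2 * c)))"
    by (simp add: mult.commute flip: cosh_of_real)
  finally have "has_bochner_integral lborel (\<lambda>y. cos (pi * t / c * y) / cosh (pi * y)) (1 / cosh (pi * t / (2 * c)))"
    by simp
  then have "has_bochner_integral lborel (\<lambda>y. cos (pi * t / c * (0 + c / pi * y)) / cosh (pi * (0 + c / pi * y)))
     ((1 / cosh (pi * t / (2 * c))) /\<^sub>R \<bar>c / pi\<bar>)"
    using assms by (subst (asm) lborel_has_bochner_integral_real_affine_iff[where c = "c / pi" and t = 0]) auto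
  moreover have "pi * t / c * (0 + c / pi * y) = t * y" "pi * (0 + c / pi * y) = c * y" for y
    using assms by simp_all
  moreover have "(1 / cosh (pi * t / (2 * c))) /\<^sub>R \<bar>c / pi\<bar> = pi / (c * cosh (pi * t / (2 * c)))"
    using assms by simp
  ultimately show ?thesis by (simp only:)
qed


section \<open>Product integrability, parity and elementary bounds\<close>

lemma integrable_gaussian: "integrable lborel (\<lambda>x::real. exp (- x\<^sup>2))"
  using has_bochner_integral_gaussian_cos[of 0 0] by (simp add: has_bochner_integral_iff)

lemma integrable_lborel_pair_mult:
  fixes f g :: "real \<Rightarrow> real"
  assumes "integrable lborel f" "integrable lborel g"
  shows "integrable (lborel \<Otimes>\<^sub>M lborel) (\<lambda>(x, y). f x * g y)"
proof (rule lborel_pair.Fubini_integrable)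
  have [measurable]: "f \<in> borel_measurable borel" "g \<in> borel_measurable borel"
    using assms by auto
  show "(\<lambda>(x, y). f x * g y) \<in> borel_measurable (lborel \<Otimes>\<^sub>M lborel)"
    by measurable
qed (use assms in \<open>auto simp: abs_mult\<close>)

lemma set_lebesgue_integral_Ici_even:
  fixes f :: "real \<Rightarrow> real"
  assumes "integrable lborel f" "\<And>x. f (- x) = f x"
  shows "(LBINT x:{0..}. f x) = (\<integral>x. f x \<partial>lborel) / 2"
proof -
  have "has_bochner_integral lborel (\<lambda>x. indicator {0..} x *\<^sub>R f x) (LBINT x:{0..}. f x)"
    unfolding set_lebesgue_integral_def using assms(1)
    by (intro has_bochner_integral_integrable integrable_mult_indicator) auto
  from has_bochner_integral_even_function[OF this assms(2)] show ?thesis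
    by (simp add: has_bochner_integral_iff)
qed

lemma lborel_integral_odd:
  fixes f :: "real \<Rightarrow> real"
  assumes "\<And>x. f (- x) = - f x"
  shows "(\<integral>x. f x \<partial>lborel) = 0"
  using lborel_integral_real_affine[of "- 1" f 0] by (simp add: assms)

lemma abs_cos_div_cosh_cosh_le_1: "\<bar>cos w / (cosh a * cosh b)\<bar> \<le> (1 :: real)"
proof -
  have "\<bar>cos w\<bar> * 1 \<le> 1 * (cosh a * cosh b)"
    using mult_mono[OF cosh_real_ge_1[of a] cosh_real_ge_1[of b]] abs_cos_le_one[of w]
    by (intro mult_mono) auto
  then show ?thesis by (simp add: abs_mult)
qed

text \<open>Since cosh is at least 1, \<open>cosh (a / 2)\<close> is at most its square, and
  \<open>cosh a\<close> exceeds that square by \<open>(sinh (a / 2))\<^sup>2\<close>.\<close>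

lemma cosh_half_div_cosh_le_1: "cosh (a / 2) / cosh a \<le> (1 :: real)"
proof -
  have "cosh (a / 2) * 1 \<le> cosh (a / 2) * cosh (a / 2)"
    by (intro mult_left_mono cosh_real_ge_1) auto
  also have "\<dots> \<le> cosh (2 * (a / 2))"
    unfolding cosh_double by (simp add: power2_eq_square)
  finally show ?thesis by simp
qed

lemma integrable_cosh_half_gaussian:
  fixes \<alpha> :: real
  shows "integrable lborel (\<lambda>x. cosh (\<alpha> * x / 2) / cosh (\<alpha> * x) * exp (- x\<^sup>2))"
proof (rule Bochner_Integration.integrable_bound[OF integrable_gaussian])
  have "\<bar>cosh (\<alpha> * x / 2) / cosh (\<alpha> * x) * exp (- x\<^sup>2)\<bar> \<le> exp (- x\<^sup>2)" for x
    using mult_right_mono[OF cosh_half_div_cosh_le_1[of "\<alpha> * x"], of "exp (- x\<^sup>2)"]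
    by (simp add: abs_mult)
  then show "AE x in lborel. norm (cosh (\<alpha> * x / 2) / cosh (\<alpha> * x) * exp (- x\<^sup>2)) \<le> norm (exp (- x\<^sup>2))"
    by simp
qed measurable

section \<open>Trading the cosine for a second sech, and symmetrising\<close>

text \<open>The second summand is the first with \<open>u\<close> and \<open>v\<close> exchanged,
  written with \<open>v + u\<close> so that it matches the integrand with swapped variables
  literally.\<close>

lemma sech_symmetrization:
  fixes u v :: real
  shows "1 / (cosh (2 * u) * cosh (u + v)) + 1 / (cosh (2 * v) * cosh (v + u))
       = 2 * (cosh u * cosh v - sinh u * sinh v) / (cosh (2 * u) * cosh (2 * v))"
proof -
  have "cosh (2 * u) + cosh (2 * v) = 2 * (cosh u * cosh v - sinh u * sinh v) * cosh (u + v)"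
  proof -
    \<comment> \<open>A difference of squares, whose factors are
      \<open>cosh u * cosh v - sinh u * sinh v\<close> and \<open>cosh (u + v)\<close>.\<close>
    have "cosh (2 * u) + cosh (2 * v) = 2 * ((cosh u)\<^sup>2 * (cosh v)\<^sup>2 - (sinh u)\<^sup>2 * (sinh v)\<^sup>2)"
      unfolding cosh_double by (simp add: cosh_square_eq algebra_simps)
    then show ?thesis
      by (simp add: cosh_add power2_eq_square algebra_simps)
  qed
  then have "2 * (cosh u * cosh v - sinh u * sinh v) / (cosh (2 * u) * cosh (2 * v))
      = (cosh (2 * u) + cosh (2 * v)) / cosh (u + v) / (cosh (2 * u) * cosh (2 * v))"
    by simp
  also have "\<dots> = 1 / (cosh (2 * u) * cosh (u + v)) + 1 / (cosh (2 * v) * cosh (v + u))"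
    by (simp add: field_simps)
  finally show ?thesis ..
qed

text \<open>Fubini for \<open>exp (- t\<^sup>2) * cos (2 * (x + t) * y) / cosh (c * y)\<close> with
  \<open>c = 2 * pi / \<alpha>\<close>: integrating over \<open>t\<close> first uses the Gaussian
  transform and gives the left side; integrating over \<open>y\<close> first uses the sech transform
  and gives the right side.\<close>

lemma integral_gaussian_cos_div_cosh:
  fixes \<alpha> x :: real
  assumes "\<alpha> > 0"
  shows "sqrt pi * (\<integral>y. exp (- y\<^sup>2) * cos (2 * x * y) / cosh (2 * pi * y / \<alpha>) \<partial>lborel)
       = \<alpha> / 2 * (\<integral>t. exp (- t\<^sup>2) / cosh (\<alpha> * (x + t) / 2) \<partial>lborel)"
proof -
  define c where "c = 2 * pi / \<alpha>"
  have c: "c > 0" using assms by (simp add: c_def)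
  have "integrable (lborel \<Otimes>\<^sub>M lborel) (\<lambda>(t, y). exp (- t\<^sup>2) * cos (2 * (x + t) * y) / cosh (c * y))"
    by (rule Bochner_Integration.integrable_bound[OF integrable_lborel_pair_mult
          [OF integrable_gaussian integrable_sech[of c]]])
      (use c in \<open>auto simp: abs_mult intro!: AE_I2 divide_right_mono mult_left_le\<close>)
  from lborel_pair.Fubini_integral[OF this]
  have "(\<integral>y. \<integral>t. exp (- t\<^sup>2) * cos (2 * (x + t) * y) / cosh (c * y) \<partial>lborel \<partial>lborel)
      = (\<integral>t. \<integral>y. exp (- t\<^sup>2) * cos (2 * (x + t) * y) / cosh (c * y) \<partial>lborel \<partial>lborel)" .
  moreover have "(\<integral>t. exp (- t\<^sup>2) * cos (2 * (x + t) * y) / cosh (c * y) \<partial>lborel)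
      = sqrt pi * (exp (- y\<^sup>2) * cos (2 * x * y) / cosh (2 * pi * y / \<alpha>))" for y
  proof -
    have "(\<integral>t. exp (- t\<^sup>2) * cos (2 * (x + t) * y) \<partial>lborel) = sqrt pi * exp (- y\<^sup>2) * cos (2 * x * y)"
      using has_bochner_integral_gaussian_cos[of y "2 * x * y"]
      by (simp add: has_bochner_integral_iff algebra_simps)
    then show ?thesis by (simp add: c_def)
  qed
  moreover have "(\<integral>y. exp (- t\<^sup>2) * cos (2 * (x + t) * y) / cosh (c * y) \<partial>lborel)
      = \<alpha> / 2 * (exp (- t\<^sup>2) / cosh (\<alpha> * (x + t) / 2))" for t
  proof -
    have "(\<integral>y. exp (- t\<^sup>2) * (cos (2 * (x + t) * y) / cosh (c * y)) \<partial>lborel)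
      = exp (- t\<^sup>2) * (pi / (c * cosh (pi * (2 * (x + t)) / (2 * c))))"
      unfolding integral_mult_right_zero
        has_bochner_integral_integral_eq[OF has_bochner_integral_sech_cos[OF c]] ..
    also have "pi * (2 * (x + t)) / (2 * c) = \<alpha> * (x + t) / 2"
      using assms by (simp add: c_def field_simps)
    finally show ?thesis using assms by (simp add: c_def)
  qed
  ultimately show ?thesis
    by (simp only: integral_mult_right_zero)
qed

lemma integral_gaussian_sech_sech:
  fixes \<alpha> :: real
  shows "(\<integral>x. \<integral>t. exp (- x\<^sup>2) * exp (- t\<^sup>2) / (cosh (\<alpha> * x) * cosh (\<alpha> * (x + t) / 2)) \<partial>lborel \<partial>lborel)
       = (\<integral>x. cosh (\<alpha> * x / 2) / cosh (\<alpha> * x) * exp (- x\<^sup>2) \<partial>lborel)\<^sup>2"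
proof -
  define A where "A = (\<lambda>x t. exp (- x\<^sup>2) * exp (- t\<^sup>2) / (cosh (\<alpha> * x) * cosh (\<alpha> * (x + t) / 2)))"
  define g where "g = (\<lambda>x. cosh (\<alpha> * x / 2) / cosh (\<alpha> * x) * exp (- x\<^sup>2))"
  define h where "h = (\<lambda>x. sinh (\<alpha> * x / 2) / cosh (\<alpha> * x) * exp (- x\<^sup>2))"
  define P :: "(real \<Rightarrow> real \<Rightarrow> real) \<Rightarrow> real" where "P = (\<lambda>B. integral\<^sup>L (lborel \<Otimes>\<^sub>M lborel) (case_prod B))"
  have bound: "\<bar>A x t\<bar> \<le> exp (- x\<^sup>2) * exp (- t\<^sup>2)" for x t
  proof -
    \<comment> \<open>The factor \<open>cos 0\<close> is 1; it brings the quotient into the form of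
      \<open>abs_cos_div_cosh_cosh_le_1\<close>.\<close>
    have "\<bar>A x t\<bar> = (exp (- x\<^sup>2) * exp (- t\<^sup>2)) * \<bar>cos 0 / (cosh (\<alpha> * x) * cosh (\<alpha> * (x + t) / 2))\<bar>"
      unfolding A_def by (simp add: abs_mult)
    also have "\<dots> \<le> exp (- x\<^sup>2) * exp (- t\<^sup>2)"
      by (intro mult_left_le abs_cos_div_cosh_cosh_le_1) auto
    finally show ?thesis .
  qed
  note gauss = integrable_lborel_pair_mult[OF integrable_gaussian integrable_gaussian]
  have A: "integrable (lborel \<Otimes>\<^sub>M lborel) (\<lambda>(x, t). A x t)"
    by (rule Bochner_Integration.integrable_bound[OF gauss])
      (use bound in \<open>auto simp: A_def abs_mult\<close>)
  have A': "integrable (lborel \<Otimes>\<^sub>M lborel) (\<lambda>(x, t). A t x)"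
    using lborel_pair.integrable_product_swap[OF A] by simp
  have g: "integrable lborel g"
    unfolding g_def by (rule integrable_cosh_half_gaussian)
  have h: "integrable lborel h"
  proof (rule Bochner_Integration.integrable_bound[OF g])
    have "\<bar>sinh u\<bar> \<le> cosh u" for u :: real
      using cosh_plus_sinh[of u] cosh_minus_sinh[of u] by (simp add: abs_le_iff) (smt (verit) exp_gt_zero)
    then show "AE x in lborel. norm (h x) \<le> norm (g x)"
      by (auto simp: g_def h_def abs_mult intro!: divide_right_mono)
  qed (simp add: h_def)
  \<comment> \<open>Invariance under swapping: integrating out the first variable of
    \<open>A\<close> first is, after renaming, integrating out the second variable of the swapped
    function first.\<close>
  have "P A = (\<integral>x. \<integral>t. A t x \<partial>lborel \<partial>lborel)"
    unfolding P_def by (rule lborel_pair.integral_snd[OF A, symmetric])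
  also have "\<dots> = P (\<lambda>x t. A t x)"
    unfolding P_def by (rule lborel_pair.integral_fst[OF A'])
  finally have "2 * P A = P A + P (\<lambda>x t. A t x)"
    by simp
  also have "\<dots> = (\<integral>z. (case z of (x, t) \<Rightarrow> A x t) + (case z of (x, t) \<Rightarrow> A t x) \<partial>(lborel \<Otimes>\<^sub>M lborel))"
    unfolding P_def by (rule Bochner_Integration.integral_add[OF A A', symmetric])
  also have "\<dots> = (\<integral>z. 2 * ((case z of (x, t) \<Rightarrow> g x * g t) - (case z of (x, t) \<Rightarrow> h x * h t)) \<partial>(lborel \<Otimes>\<^sub>M lborel))"
  proof (intro Bochner_Integration.integral_cong refl)
    fix z :: "real \<times> real"
    obtain x t where z: "z = (x, t)" by force
    define u v where "u = \<alpha> * x / 2" and "v = \<alpha> * t / 2"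
    have uv: "\<alpha> * x = 2 * u" "\<alpha> * t = 2 * v" "\<alpha> * (x + t) / 2 = u + v" "\<alpha> * (t + x) / 2 = v + u"
      by (simp_all add: u_def v_def algebra_simps add_divide_distrib)
    have "A x t + A t x = (exp (- x\<^sup>2) * exp (- t\<^sup>2)) *
        (1 / (cosh (2 * u) * cosh (u + v)) + 1 / (cosh (2 * v) * cosh (v + u)))"
      unfolding A_def uv by (simp add: distrib_left)
    also have "\<dots> = 2 * (g x * g t - h x * h t)"
      unfolding sech_symmetrization g_def h_def uv by (simp add: diff_divide_distrib algebra_simps)
    finally show "(case z of (x, t) \<Rightarrow> A x t) + (case z of (x, t) \<Rightarrow> A t x)
      = 2 * ((case z of (x, t) \<Rightarrow> g x * g t) - (case z of (x, t) \<Rightarrow> h x * h t))"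
      by (simp add: z)
  qed
  also have "\<dots> = 2 * (P (\<lambda>x t. g x * g t) - P (\<lambda>x t. h x * h t))"
    unfolding P_def integral_mult_right_zero
    using integrable_lborel_pair_mult[OF g g] integrable_lborel_pair_mult[OF h h]
    by (subst Bochner_Integration.integral_diff) auto
  also have "P (\<lambda>x t. g x * g t) = (\<integral>x. g x \<partial>lborel)\<^sup>2"
    unfolding P_def lborel_pair.integral_fst[OF integrable_lborel_pair_mult[OF g g], symmetric]
    by (simp add: power2_eq_square)
  also have "P (\<lambda>x t. h x * h t) = (\<integral>x. h x \<partial>lborel)\<^sup>2"
    unfolding P_def lborel_pair.integral_fst[OF integrable_lborel_pair_mult[OF h h], symmetric]
    by (simp add: power2_eq_square)
  also have "(\<integral>x. h x \<partial>lborel) = 0"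
    by (rule lborel_integral_odd) (simp add: h_def)
  finally have "P A = (\<integral>x. g x \<partial>lborel)\<^sup>2" by simp
  moreover have "P A = (\<integral>x. \<integral>t. A x t \<partial>lborel \<partial>lborel)"
    unfolding P_def by (rule lborel_pair.integral_fst[OF A, symmetric])
  ultimately show ?thesis by (simp add: A_def g_def)
qed

section \<open>From the quadrant to the plane, and conclusion\<close>

theorem mainTheorem9:
  fixes \<alpha> :: real
  assumes "\<alpha> > 0"
  shows "(LBINT y:{0..}. LBINT x:{0..}.
            exp (- x\<^sup>2 - y\<^sup>2) * cos (2 * x * y) / (cosh (\<alpha> * x) * cosh (2 * pi * y / \<alpha>)))
       = \<alpha> / (2 * sqrt pi) *
           (LBINT x:{0..}. cosh (\<alpha> * x / 2) / cosh (\<alpha> * x) * exp (- x\<^sup>2))\<^sup>2"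
proof -
  define F where "F = (\<lambda>x y. exp (- x\<^sup>2 - y\<^sup>2) * cos (2 * x * y) / (cosh (\<alpha> * x) * cosh (2 * pi * y / \<alpha>)))"
  have bound: "\<bar>F x y\<bar> \<le> exp (- x\<^sup>2) * exp (- y\<^sup>2)" for x y
  proof -
    have "\<bar>F x y\<bar> = (exp (- x\<^sup>2) * exp (- y\<^sup>2)) * \<bar>cos (2 * x * y) / (cosh (\<alpha> * x) * cosh (2 * pi * y / \<alpha>))\<bar>"
      unfolding F_def by (simp add: abs_mult exp_diff exp_minus field_simps)
    also have "\<dots> \<le> exp (- x\<^sup>2) * exp (- y\<^sup>2)"
      by (intro mult_left_le abs_cos_div_cosh_cosh_le_1) auto
    finally show ?thesis .
  qed
  note gauss = integrable_lborel_pair_mult[OF integrable_gaussian integrable_gaussian]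
  have F: "integrable (lborel \<Otimes>\<^sub>M lborel) (\<lambda>(x, y). F x y)"
    by (rule Bochner_Integration.integrable_bound[OF gauss])
      (use bound in \<open>auto simp: F_def abs_mult\<close>)
  \<comment> \<open>Fubini alone would give this for almost every \<open>y\<close>; the halving of
    the inner integral below is applied at each \<open>y\<close>.\<close>
  have F_x: "integrable lborel (\<lambda>x. F x y)" for y
    by (rule Bochner_Integration.integrable_bound[OF integrable_mult_left[OF integrable_gaussian, of "exp (- y\<^sup>2)"]])
      (use bound[of _ y] in \<open>auto simp: F_def abs_mult\<close>)
  \<comment> \<open>The factor \<open>w\<close> depends on \<open>x\<close> only, so it passes
    through both the \<open>y\<close>-integral and the \<open>t\<close>-integral.\<close>
  have inner: "(\<integral>y. F x y \<partial>lborel) = \<alpha> / (2 * sqrt pi) *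
      (\<integral>t. exp (- x\<^sup>2) * exp (- t\<^sup>2) / (cosh (\<alpha> * x) * cosh (\<alpha> * (x + t) / 2)) \<partial>lborel)" for x
  proof -
    define w where "w = exp (- x\<^sup>2) / cosh (\<alpha> * x)"
    have "(\<integral>y. F x y \<partial>lborel) = (\<integral>y. w * (exp (- y\<^sup>2) * cos (2 * x * y) / cosh (2 * pi * y / \<alpha>)) \<partial>lborel)"
      unfolding F_def w_def
      by (intro Bochner_Integration.integral_cong) (simp_all add: exp_diff exp_minus field_simps)
    also have "\<dots> = w * ((sqrt pi * (\<integral>y. exp (- y\<^sup>2) * cos (2 * x * y) / cosh (2 * pi * y / \<alpha>) \<partial>lborel)) / sqrt pi)"
      by (simp only: integral_mult_right_zero) simp
    also have "\<dots> = \<alpha> / (2 * sqrt pi) * (w * (\<integral>t. exp (- t\<^sup>2) / cosh (\<alpha> * (x + t) / 2) \<partial>lborel))"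
      unfolding integral_gaussian_cos_div_cosh[OF assms] by simp
    also have "w * (\<integral>t. exp (- t\<^sup>2) / cosh (\<alpha> * (x + t) / 2) \<partial>lborel)
        = (\<integral>t. w * (exp (- t\<^sup>2) / cosh (\<alpha> * (x + t) / 2)) \<partial>lborel)"
      by (rule integral_mult_right_zero[symmetric])
    finally show ?thesis by (simp add: w_def)
  qed
  \<comment> \<open>\<open>F\<close> is even in each variable separately, so each half-line
    contributes a factor 1/2.\<close>
  have "(LBINT x:{0..}. F x y) = (\<integral>x. F x y \<partial>lborel) / 2" for y
    by (rule set_lebesgue_integral_Ici_even[OF F_x]) (simp add: F_def)
  then have "(LBINT y:{0..}. LBINT x:{0..}. F x y) = (LBINT y:{0..}. (\<integral>x. F x y \<partial>lborel) / 2)"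
    by (simp only:)
  also have "\<dots> = (\<integral>y. (\<integral>x. F x y \<partial>lborel) / 2 \<partial>lborel) / 2"
  proof (rule set_lebesgue_integral_Ici_even)
    show "integrable lborel (\<lambda>y. (\<integral>x. F x y \<partial>lborel) / 2)"
      by (intro integrable_divide lborel_pair.integrable_snd F)
  qed (simp add: F_def)
  also have "\<dots> = (\<integral>x. \<integral>y. F x y \<partial>lborel \<partial>lborel) / 4"
    unfolding lborel_pair.Fubini_integral[OF F, symmetric] by simp
  \<comment> \<open>The factor 1/4 from the quadrant moves inside the square as 1/2, which is what
    turns the full-line integral back into one over the half-line.\<close>
  also have "\<dots> = \<alpha> / (2 * sqrt pi) * ((\<integral>x. cosh (\<alpha> * x / 2) / cosh (\<alpha> * x) * exp (- x\<^sup>2) \<partial>lborel) / 2)\<^sup>2"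
    unfolding inner integral_mult_right_zero integral_gaussian_sech_sech by (simp add: power2_eq_square)
  also have "(\<integral>x. cosh (\<alpha> * x / 2) / cosh (\<alpha> * x) * exp (- x\<^sup>2) \<partial>lborel) / 2
      = (LBINT x:{0..}. cosh (\<alpha> * x / 2) / cosh (\<alpha> * x) * exp (- x\<^sup>2))"
    by (rule set_lebesgue_integral_Ici_even[symmetric, OF integrable_cosh_half_gaussian]) simp
  finally show ?thesis unfolding F_def .
qed

end
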